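(* Let $r,\tilde r\ge 1$ be integers and $D=3r+3\tilde r-2$. Let $\boldsymbol\eta=(\mathbf s,\mathbf t,\mathbf w,\tilde{\mathbf s},\tilde{\mathbf t},\tilde{\mathbf w})$ be $D$ variables with $\mathbf s=(s_0,\dots,s_{r-1})$, $\mathbf t=(t_0,\dots,t_{r-1})$, $\mathbf w=(w_0,\dots,w_{r-2})$, $\tilde{\mathbf s}=(\tilde s_0,\dots,\tilde s_{\tilde r-1})$, $\tilde{\mathbf t}=(\tilde t_0,\dots,\tilde t_{\tilde r-1})$, $\tilde{\mathbf w}=(\tilde w_0,\dots,\tilde w_{\tilde r-2})$, and adopt the conventions $w_{r-1}=0$, $\tilde w_{\tilde r-1}=0$. Let $\boldsymbol\varphi=(\mathbf f,\mathbf g,\mathbf h,\tilde{\mathbf f},\tilde{\mathbf g},\tilde{\mathbf h})$ be the $D$ rational functions of $\boldsymbol\eta$ (in matching order, $\varphi_k$ corresponding to $\eta_k$) $$f_i=\tilde g_j=\frac{1+w_0}{1+s_0+t_0},\qquad \tilde f_j=g_i=\frac{1+\tilde w_0}{1+\tilde s_0+\tilde t_0}\qquad(0\le i\le r-1,\ 0\le j\le \tilde r-1),$$ $$h_i=\frac{(1+w_i)(1+w_{i+1})}{(1+s_i+t_i)(1+s_{i+1}+t_{i+1})}\ (0\le i\le r-2),\qquad \tilde h_i=\frac{(1+\tilde w_i)(1+\tilde w_{i+1})}{(1+\tilde s_i+\tilde t_i)(1+\tilde s_{i+1}+\tilde t_{i+1})}\ (0\le i\le \tilde r-2).$$ Let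 $$J=\det\Bigl(\delta_{jk}-\frac{\eta_k}{\varphi_j}\frac{\partial\varphi_j}{\partial\eta_k}\Bigr)_{j,k=1}^{D}.$$ Then $$J=S\tilde S-T\tilde T,$$ where $$S=\frac1W\Bigl(1+\sum_{j=0}^{r-1}\frac{s_j(1+w_j)}{1+s_j+t_j}\prod_{k=0}^{j-1}w_k\Bigr),\qquad T=\frac1W\sum_{j=0}^{r-1}\frac{t_j(1+w_j)}{1+s_j+t_j}\prod_{k=0}^{j-1}w_k,\qquad W=\prod_{k=0}^{r-2}(1+w_k),$$ and $\tilde S,\tilde T$ are obtained from $S,T$ by replacing $r,s_j,t_j,w_j$ by $\tilde r,\tilde s_j,\tilde t_j,\tilde w_j$.
   Context: Empty sums are $0$ and empty products are $1$. The functions $\boldsymbol\varphi$ are those appearing in a Lagrange-inversion reformulation of the eigenproblem for a tridiagonal matrix. *)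

theory Defs
  imports "HOL-Analysis.Derivative" "Jordan_Normal_Form.Determinant"
begin

(* The six families of variables; the second triple is the one with tildes. *)
datatype var = s_var nat | t_var nat | w_var nat | s'_var nat | t'_var nat | w'_var nat

(* The list fixes the order of rows and columns. It omits w_(r-1) and w'_(r'-1):
   these occur in phi, S and T below, but by convention they are the constant 0,
   and no derivative is taken with respect to them. *)
definition variables :: "nat \<Rightarrow> nat \<Rightarrow> var list" where
  "variables r r' =
     map s_var [0..<r] @ map t_var [0..<r] @ map w_var [0..<r - 1] @
     map s'_var [0..<r'] @ map t'_var [0..<r'] @ map w'_var [0..<r' - 1]"

lemma length_variables:
  assumes "r \<ge> 1" "r' \<ge> 1"
  shows "length (variables r r') = 3 * r + 3 * r' - 2"
  using assms by (simp add: variables_def)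

fun phi :: "var \<Rightarrow> (var \<Rightarrow> 'a::field) \<Rightarrow> 'a" where
  "phi (s_var i) \<eta> = (1 + \<eta> (w_var 0)) / (1 + \<eta> (s_var 0) + \<eta> (t_var 0))"
| "phi (t_var i) \<eta> = (1 + \<eta> (w'_var 0)) / (1 + \<eta> (s'_var 0) + \<eta> (t'_var 0))"
| "phi (w_var i) \<eta> =
     ((1 + \<eta> (w_var i)) * (1 + \<eta> (w_var (i + 1)))) /
     ((1 + \<eta> (s_var i) + \<eta> (t_var i)) * (1 + \<eta> (s_var (i + 1)) + \<eta> (t_var (i + 1))))"
| "phi (s'_var j) \<eta> = (1 + \<eta> (w'_var 0)) / (1 + \<eta> (s'_var 0) + \<eta> (t'_var 0))"
| "phi (t'_var j) \<eta> = (1 + \<eta> (w_var 0)) / (1 + \<eta> (s_var 0) + \<eta> (t_var 0))"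
| "phi (w'_var i) \<eta> =
     ((1 + \<eta> (w'_var i)) * (1 + \<eta> (w'_var (i + 1)))) /
     ((1 + \<eta> (s'_var i) + \<eta> (t'_var i)) * (1 + \<eta> (s'_var (i + 1)) + \<eta> (t'_var (i + 1))))"

definition partial_deriv ::
    "var \<Rightarrow> ((var \<Rightarrow> 'a::real_normed_field) \<Rightarrow> 'a) \<Rightarrow> (var \<Rightarrow> 'a) \<Rightarrow> 'a" where
  "partial_deriv v F \<eta> = deriv (\<lambda>x. F (\<eta>(v := x))) (\<eta> v)"

definition J :: "nat \<Rightarrow> nat \<Rightarrow> (var \<Rightarrow> 'a::real_normed_field) \<Rightarrow> 'a" where
  "J r r' \<eta> =
     (let D = 3 * r + 3 * r' - 2; v = (\<lambda>k. variables r r' ! k)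
      in det (mat D D (\<lambda>(j, k).
           (if j = k then 1 else 0) -
           \<eta> (v k) / phi (v j) \<eta> * partial_deriv (v k) (phi (v j)) \<eta>)))"

definition W :: "nat \<Rightarrow> (nat \<Rightarrow> 'a::field) \<Rightarrow> 'a" where
  "W r w = (\<Prod>k<r - 1. 1 + w k)"

definition S :: "nat \<Rightarrow> (nat \<Rightarrow> 'a::field) \<Rightarrow> (nat \<Rightarrow> 'a) \<Rightarrow> (nat \<Rightarrow> 'a) \<Rightarrow> 'a" where
  "S r s t w =
     1 / W r w * (1 + (\<Sum>j<r. s j * (1 + w j) / (1 + s j + t j) * (\<Prod>k<j. w k)))"

definition T :: "nat \<Rightarrow> (nat \<Rightarrow> 'a::field) \<Rightarrow> (nat \<Rightarrow> 'a) \<Rightarrow> (nat \<Rightarrow> 'a) \<Rightarrow> 'a" where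
  "T r s t w =
     1 / W r w * (\<Sum>j<r. t j * (1 + w j) / (1 + s j + t j) * (\<Prod>k<j. w k))"

end

theory Submission
  imports Defs
begin

text \<open>
  Every \<^term>\<open>phi x\<close> is a product of the \<open>r + r'\<close> quotients
  \<open>u m = (1 + w m) / (1 + s m + t m)\<close> (and their primed analogues), so the matrix of logarithmic
  derivatives factors as \<open>A * B\<close>, with \<open>A\<close> the exponents and \<open>B\<close> the logarithmic derivatives
  of the \<open>u m\<close>. Sylvester's identity \<open>det (1 - A * B) = det (1 - B * A)\<close> reduces \<open>J\<close> to a
  determinant of size \<open>r + r'\<close>. After scaling the rows, that matrix is the sum of an upper bidiagonal
  one and two full columns. It decouples into two blocks because \<open>w (r - 1) = 0\<close>. Factoring out the
  bidiagonal part and applying Sylvester's identity again leaves a \<open>2 \<times> 2\<close> determinant.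
\<close>

section \<open>Determinant identities for \<open>1 - A * B\<close> and for size 2\<close>

text \<open>The block matrix with rows \<open>(1, A)\<close> and \<open>(B, 1)\<close> factors into
  block triangular matrices in two ways; one factorization leaves \<open>1 - B * A\<close> on the
  diagonal, the other \<open>1 - A * B\<close>.\<close>

lemma det_one_minus_mult_swap:
  fixes A B :: "'a::idom mat"
  assumes A: "A \<in> carrier_mat n m" and B: "B \<in> carrier_mat m n"
  shows "det (1\<^sub>m n - A * B) = det (1\<^sub>m m - B * A)"
proof -
  let ?M = "four_block_mat (1\<^sub>m n) A B (1\<^sub>m m)"
  have AB: "1\<^sub>m n - A * B \<in> carrier_mat n n" and BA: "1\<^sub>m m - B * A \<in> carrier_mat m m"
    using A B by (auto intro: minus_carrier_mat)
  have "?M = four_block_mat (1\<^sub>m n) (0\<^sub>m n m) B (1\<^sub>m m)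
      * four_block_mat (1\<^sub>m n) A (0\<^sub>m m n) (1\<^sub>m m - B * A)"
    using A B
    by (subst mult_four_block_mat[of _ n n _ m _ m _ _ n _ m])
      (auto intro!: cong_four_block_mat eq_matI)
  then have "det ?M = det (1\<^sub>m m - B * A)"
    using A B BA
    by (simp add: det_mult[of _ "n + m"] det_four_block_mat_upper_right_zero[of _ n _ m]
        det_four_block_mat_lower_left_zero[of _ n _ m])
  moreover have "?M = four_block_mat (1\<^sub>m n - A * B) A (0\<^sub>m m n) (1\<^sub>m m)
      * four_block_mat (1\<^sub>m n) (0\<^sub>m n m) B (1\<^sub>m m)"
    using A B
    by (subst mult_four_block_mat[of _ n n _ m _ m _ _ n _ m])
      (auto intro!: cong_four_block_mat eq_matI)
  then have "det ?M = det (1\<^sub>m n - A * B)"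
    using A B AB
    by (simp add: det_mult[of _ "n + m"] det_four_block_mat_upper_right_zero[of _ n _ m]
        det_four_block_mat_lower_left_zero[of _ n _ m])
  ultimately show ?thesis by simp
qed

lemma det_mat_2:
  fixes A :: "'a::idom mat"
  assumes A: "A \<in> carrier_mat 2 2"
  shows "det A = A $$ (0,0) * A $$ (1,1) - A $$ (0,1) * A $$ (1,0)"
proof -
  let ?a = "\<lambda>i j. mat 1 1 (\<lambda>_. A $$ (i, j))"
  have A_eq: "A = four_block_mat (?a 0 0) (?a 0 1) (?a 1 0) (?a 1 1)"
  proof (rule eq_matI)
    fix i j
    assume "i < dim_row (four_block_mat (?a 0 0) (?a 0 1) (?a 1 0) (?a 1 1))"
      and "j < dim_col (four_block_mat (?a 0 0) (?a 0 1) (?a 1 0) (?a 1 1))"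
    then have "i = 0 \<or> i = 1" "j = 0 \<or> j = 1" by auto
    then show "A $$ (i, j) = four_block_mat (?a 0 0) (?a 0 1) (?a 1 0) (?a 1 1) $$ (i, j)"
      by auto
  qed (use A in auto)
  have "det A = det (four_block_mat (?a 0 0) (?a 0 1) (?a 1 0) (?a 1 1))"
    by (rule arg_cong[OF A_eq])
  also have "\<dots> = det (?a 0 0 * ?a 1 1 - ?a 0 1 * ?a 1 0)"
  proof (rule det_four_block_mat)
    \<comment> \<open>The block determinant formula needs commuting lower blocks; here all blocks
      have size 1.\<close>
    show "?a 1 0 * ?a 1 1 = ?a 1 1 * ?a 1 0"
      by (rule eq_matI) (simp_all add: scalar_prod_def mult.commute)
  qed (rule mat_carrier)+
  also have "\<dots> = (?a 0 0 * ?a 1 1 - ?a 0 1 * ?a 1 0) $$ (0, 0)"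
    by (rule det_single, rule carrier_matI) simp_all
  also have "\<dots> = A $$ (0,0) * A $$ (1,1) - A $$ (0,1) * A $$ (1,0)"
    by (simp add: scalar_prod_def)
  finally show ?thesis .
qed

section \<open>Back substitution and the bidiagonal determinant\<close>

text \<open>This is the solution \<open>x\<close> of the bidiagonal system
  \<open>x i - z i * x (Suc i) = f i\<close> for \<open>i < n\<close> with \<open>x n = 0\<close>.
  At \<open>i = 0\<close> it has the shape of the sums in \<open>S\<close> and
  \<open>T\<close>.\<close>

definition tail_sum :: "nat \<Rightarrow> (nat \<Rightarrow> 'a::comm_ring_1) \<Rightarrow> (nat \<Rightarrow> 'a) \<Rightarrow> nat \<Rightarrow> 'a" where
  "tail_sum n z f i = (\<Sum>j=i..<n. f j * (\<Prod>k=i..<j. z k))"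

lemma tail_sum_ge: "n \<le> i \<Longrightarrow> tail_sum n z f i = 0"
  by (simp add: tail_sum_def)

lemma tail_sum_rec:
  assumes "i < n"
  shows "tail_sum n z f i = f i + z i * tail_sum n z f (Suc i)"
proof -
  have "(\<Prod>k=i..<j. z k) = z i * (\<Prod>k=Suc i..<j. z k)" if "j \<in> {Suc i..<n}" for j
    using that by (simp add: prod.atLeast_Suc_lessThan)
  then show ?thesis
    using assms
    by (simp add: tail_sum_def sum.atLeast_Suc_lessThan sum_distrib_left algebra_simps)
qed

lemma tail_sum_shift:
  "tail_sum (a + n) z f a = tail_sum n (\<lambda>i. z (a + i)) (\<lambda>i. f (a + i)) 0"
  using sum.shift_bounds_nat_ivl[of "\<lambda>j. f j * (\<Prod>k=a..<j. z k)" 0 a n]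
    prod.shift_bounds_nat_ivl[of z 0 a]
  by (simp add: tail_sum_def add.commute)

text \<open>Every term from index \<open>a\<close> on contains the factor \<open>z (a - 1)\<close>.
  This is what decouples the two blocks.\<close>

lemma tail_sum_cut:
  assumes "0 < a" and "z (a - 1) = 0"
  shows "tail_sum (a + n) z f 0 = tail_sum a z f 0"
proof -
  have "(\<Prod>k=0..<j. z k) = 0" if "a \<le> j" for j
    using that assms by (intro prod_zero bexI[of _ "a - 1"]) auto
  then show ?thesis
    unfolding tail_sum_def by (intro sum.mono_neutral_right) auto
qed

lemma tail_sum_cong:
  assumes "\<And>i. i < n \<Longrightarrow> z i = z' i" and "\<And>i. i < n \<Longrightarrow> f i = f' i"
  shows "tail_sum n z f 0 = tail_sum n z' f' 0"
  unfolding tail_sum_def using assms by (intro sum.cong arg_cong2[of _ _ _ _ "(*)"] prod.cong) auto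

text \<open>The matrix is a bidiagonal \<open>R\<close> times a perturbation of the identity of rank
  at most 2, so swapping the factors of the perturbation leaves a determinant of size 2.\<close>

lemma det_bidiagonal_plus_two_columns:
  fixes c z p q :: "nat \<Rightarrow> 'a::idom"
  assumes a: "a < n" and b: "b < n"
  shows "det (mat n n (\<lambda>(i, j). c i * (of_bool (i = j) - of_bool (j = Suc i) * z i
           + of_bool (j = a) * p i + of_bool (j = b) * q i)))
       = (\<Prod>i<n. c i) * ((1 + tail_sum n z p a) * (1 + tail_sum n z q b)
           - tail_sum n z q a * tail_sum n z p b)"
    (is "det ?M = _")
proof -
  define R where "R = mat n n (\<lambda>(i, j). c i * (of_bool (i = j) - of_bool (j = Suc i) * z i))"
  \<comment> \<open>The columns of \<open>P\<close> solve the bidiagonal system for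
    \<open>-p\<close> and \<open>-q\<close>, so \<open>R * P\<close> has the entries
    \<open>- c i * p i\<close> and \<open>- c i * q i\<close>; \<open>Q\<close> places them in
    columns \<open>a\<close> and \<open>b\<close>.\<close>
  define P where "P = mat n 2 (\<lambda>(i, k). - tail_sum n z (if k = 0 then p else q) i)"
  define Q where "Q = mat 2 n (\<lambda>(k, j). of_bool (j = (if k = 0 then a else b)) :: 'a)"
  have carr [simp]: "R \<in> carrier_mat n n" "P \<in> carrier_mat n 2" "Q \<in> carrier_mat 2 n"
    by (simp_all add: R_def P_def Q_def)
  have diff [simp]: "1\<^sub>m n - P * Q \<in> carrier_mat n n"
    by (intro minus_carrier_mat mult_carrier_mat[of _ _ 2]) simp_all
  have two: "{0..<2} = {0, Suc 0}" by auto
  have PQ: "(P * Q) $$ (i, j) = - (of_bool (j = a) * tail_sum n z p i + of_bool (j = b) * tail_sum n z q i)"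
    if "i < n" "j < n" for i j
    using that by (simp add: P_def Q_def scalar_prod_def two)
  have QP: "(Q * P) $$ (k, l) =
      - tail_sum n z (if l = 0 then p else q) (if k = 0 then a else b)"
    if "k < 2" "l < 2" for k l
  proof -
    define x where "x = (if k = 0 then a else b)"
    define f where "f = (if l = 0 then p else q)"
    have "x < n" using a b by (simp add: x_def)
    have "(Q * P) $$ (k, l) = (\<Sum>i<n. of_bool (i = x) * - tail_sum n z f i)"
      using that by (simp add: P_def Q_def scalar_prod_def atLeast0LessThan x_def f_def)
    also have "\<dots> = (\<Sum>i<n. if i = x then - tail_sum n z f i else 0)"
      by (rule sum.cong) auto
    also have "\<dots> = - tail_sum n z f x"
      using \<open>x < n\<close> by simp
    finally show ?thesis by (simp only: x_def f_def)
  qed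
  \<comment> \<open>The last row of \<open>R\<close> has no superdiagonal entry, hence the case
    distinction.\<close>
  have R_mult: "(R * X) $$ (i, j) = c i * (X $$ (i, j) - (if Suc i < n then z i * X $$ (Suc i, j) else 0))"
    if X: "X \<in> carrier_mat n n" and ij: "i < n" "j < n" for X i j
  proof -
    have "(R * X) $$ (i, j) = (\<Sum>k<n. c i * (of_bool (i = k) - of_bool (k = Suc i) * z i) * X $$ (k, j))"
      using X ij by (simp add: R_def scalar_prod_def atLeast0LessThan)
    also have "\<dots> = (\<Sum>k<n. (if k = i then c i * X $$ (k, j) else 0)
        - (if k = Suc i then c i * z i * X $$ (k, j) else 0))"
      by (intro sum.cong) auto
    also have "\<dots> = c i * (X $$ (i, j) - (if Suc i < n then z i * X $$ (Suc i, j) else 0))"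
      using ij by (simp add: sum_subtractf algebra_simps)
    finally show ?thesis .
  qed
  have "?M = R * (1\<^sub>m n - P * Q)"
  proof (rule eq_matI)
    fix i j assume "i < dim_row (R * (1\<^sub>m n - P * Q))" "j < dim_col (R * (1\<^sub>m n - P * Q))"
    then have ij: "i < n" "j < n" by (simp_all add: R_def Q_def)
    have X: "(1\<^sub>m n - P * Q) $$ (l, j) = of_bool (l = j)
        + (of_bool (j = a) * tail_sum n z p l + of_bool (j = b) * tail_sum n z q l)"
      if "l < n" for l
      using that ij PQ[of l j] by (simp add: P_def Q_def)
    show "?M $$ (i, j) = (R * (1\<^sub>m n - P * Q)) $$ (i, j)"
    proof (cases "Suc i < n")
      case True
      then show ?thesis
        using ij by (subst R_mult) (simp_all add: X tail_sum_rec[of i] algebra_simps)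
    next
      case False
      \<comment> \<open>In the last row the recursion ends with
        \<open>tail_sum n z f n = 0\<close>.\<close>
      then have "Suc i = n" using ij by simp
      then show ?thesis
        using ij by (subst R_mult) (simp_all add: X tail_sum_rec[of i] tail_sum_ge algebra_simps)
    qed
  qed (simp_all add: R_def Q_def)
  then have "det ?M = det R * det (1\<^sub>m n - P * Q)"
    by (simp add: det_mult[of _ n])
  also have "det R = (\<Prod>i<n. c i)"
    by (subst det_upper_triangular[of _ n])
      (auto simp: R_def prod_list_diag_prod atLeast0LessThan intro!: prod.cong)
  also have "det (1\<^sub>m n - P * Q) = det (1\<^sub>m 2 - Q * P)"
    by (rule det_one_minus_mult_swap) simp_all
  also have "\<dots> = (1 + tail_sum n z p a) * (1 + tail_sum n z q b)
           - tail_sum n z q a * tail_sum n z p b"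
  proof -
    have carr: "Q * P \<in> carrier_mat 2 2" by (rule mult_carrier_mat[of _ _ n]) simp_all
    then have "1\<^sub>m 2 - Q * P \<in> carrier_mat 2 2" by (rule minus_carrier_mat)
    moreover have "(1\<^sub>m 2 - Q * P) $$ (k, l) = of_bool (k = l) - (Q * P) $$ (k, l)"
      if "k < 2" "l < 2" for k l
      using that carrier_matD[OF carr] by (simp del: index_mult_mat)
    ultimately show ?thesis
      by (simp add: det_mat_2 QP del: index_mult_mat)
  qed
  finally show ?thesis .
qed

section \<open>Logarithmic derivatives of \<open>phi\<close>\<close>

text \<open>This is \<open>\<eta> v\<close> times the \<open>v\<close>-derivative of log
  \<open>F\<close>, the quantity subtracted in each entry of \<open>J\<close>, written without
  choosing a logarithm.\<close>

definition log_deriv :: "var \<Rightarrow> ((var \<Rightarrow> 'a::real_normed_field) \<Rightarrow> 'a) \<Rightarrow> (var \<Rightarrow> 'a) \<Rightarrow> 'a" where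
  "log_deriv v F \<eta> = \<eta> v / F \<eta> * partial_deriv v F \<eta>"

text \<open>The arguments are variables rather than values, so that one differentiation serves both
  families.\<close>

definition quot :: "var \<Rightarrow> var \<Rightarrow> var \<Rightarrow> (var \<Rightarrow> 'a::field) \<Rightarrow> 'a" where
  "quot a b c \<eta> = (1 + \<eta> c) / (1 + \<eta> a + \<eta> b)"

text \<open>The value is split off as a factor so that \<open>log_deriv_eqI\<close> can cancel it.
  Distinctness of the variables ensures that an update at \<open>v\<close> changes at most one of
  the three entries.\<close>

lemma quot_has_field_derivative:
  fixes \<eta> :: "var \<Rightarrow> 'a::real_normed_field"
  assumes "a \<noteq> b" "a \<noteq> c" "b \<noteq> c" and "1 + \<eta> a + \<eta> b \<noteq> 0" and "1 + \<eta> c \<noteq> 0"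
  shows "((\<lambda>x. quot a b c (\<eta>(v := x))) has_field_derivative
    quot a b c \<eta> * (if v = a \<or> v = b then - 1 / (1 + \<eta> a + \<eta> b)
      else if v = c then 1 / (1 + \<eta> c) else 0)) (at (\<eta> v))"
proof -
  consider "v = a" | "v = b" | "v = c" | "v \<noteq> a" "v \<noteq> b" "v \<noteq> c" by blast
  then show ?thesis
    by cases (use assms in \<open>auto simp: quot_def divide_simps intro!: derivative_eq_intros\<close>)
qed

lemma log_deriv_eqI:
  assumes "((\<lambda>x. F (\<eta>(v := x))) has_field_derivative F \<eta> * d) (at (\<eta> v))" and "F \<eta> \<noteq> 0"
  shows "log_deriv v F \<eta> = \<eta> v * d"
  using assms by (simp add: log_deriv_def partial_deriv_def DERIV_imp_deriv)

lemma log_deriv_quot: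
  assumes "a \<noteq> b" "a \<noteq> c" "b \<noteq> c" and "1 + \<eta> a + \<eta> b \<noteq> 0" and "1 + \<eta> c \<noteq> 0"
  shows "log_deriv v (quot a b c) \<eta> = (if v = a \<or> v = b then - \<eta> v / (1 + \<eta> a + \<eta> b)
    else if v = c then \<eta> v / (1 + \<eta> c) else 0)"
  by (subst log_deriv_eqI[OF quot_has_field_derivative]) (use assms in \<open>auto simp: quot_def\<close>)

lemma log_deriv_mult:
  assumes "(\<lambda>x. F (\<eta>(v := x))) field_differentiable at (\<eta> v)" "F \<eta> \<noteq> 0"
    and "(\<lambda>x. G (\<eta>(v := x))) field_differentiable at (\<eta> v)" "G \<eta> \<noteq> 0"
  shows "log_deriv v (\<lambda>\<eta>. F \<eta> * G \<eta>) \<eta> = log_deriv v F \<eta> + log_deriv v G \<eta>"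
  using assms by (simp add: log_deriv_def partial_deriv_def field_simps)

text \<open>The two families of quotients are numbered consecutively: indices from \<open>r\<close> on are primed.\<close>

definition potential :: "nat \<Rightarrow> nat \<Rightarrow> (var \<Rightarrow> 'a::field) \<Rightarrow> 'a" where
  "potential r m = (if m < r then quot (s_var m) (t_var m) (w_var m)
     else quot (s'_var (m - r)) (t'_var (m - r)) (w'_var (m - r)))"

text \<open>The exponent of \<^term>\<open>potential r m\<close> in \<^term>\<open>phi x\<close>.\<close>

fun expo :: "nat \<Rightarrow> var \<Rightarrow> nat \<Rightarrow> 'a::comm_ring_1" where
  "expo r (s_var i) m = of_bool (m = 0)"
| "expo r (t_var i) m = of_bool (m = r)"
| "expo r (w_var i) m = of_bool (m = i) + of_bool (m = Suc i)"
| "expo r (s'_var i) m = of_bool (m = r)"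
| "expo r (t'_var i) m = of_bool (m = 0)"
| "expo r (w'_var i) m = of_bool (m = r + i) + of_bool (m = Suc (r + i))"

text \<open>Each \<open>phi x\<close> is one potential or a product of two, and logarithmic
  derivatives turn products into sums.\<close>

lemma log_deriv_phi:
  fixes \<eta> :: "var \<Rightarrow> 'a::real_normed_field"
  assumes r: "r \<ge> 1" "r' \<ge> 1" and x: "x \<in> set (variables r r')"
    and nz: "\<And>m. m < r + r' \<Longrightarrow> potential r m \<eta> \<noteq> 0"
  shows "log_deriv v (phi x) \<eta> = (\<Sum>m<r + r'. expo r x m * log_deriv v (potential r m) \<eta>)"
proof -
  \<comment> \<open>Since division by zero gives 0, a nonzero quotient has nonzero numerator and
    denominator.\<close>
  have nz_quot: "1 + \<eta> c \<noteq> 0" "1 + \<eta> a + \<eta> b \<noteq> 0" if "quot a b c \<eta> \<noteq> 0" for a b c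
    using that by (auto simp: quot_def)
  have diff: "(\<lambda>x. potential r m (\<eta>(v := x))) field_differentiable at (\<eta> v)" if "m < r + r'" for m
    using nz[OF that] unfolding potential_def field_differentiable_def
    by (auto intro!: exI quot_has_field_derivative nz_quot split: if_splits)
  have two: "log_deriv v (\<lambda>\<eta>. potential r m \<eta> * potential r (Suc m) \<eta>) \<eta> =
      log_deriv v (potential r m) \<eta> + log_deriv v (potential r (Suc m)) \<eta>" if "Suc m < r + r'" for m
    using that by (intro log_deriv_mult diff nz) auto
  show ?thesis
  proof (cases x)
    case (s_var i)
    have "phi x = (potential r 0 :: (var \<Rightarrow> 'a) \<Rightarrow> 'a)"
      using r by (auto simp: s_var potential_def quot_def)
    then show ?thesis using r by (simp add: s_var)
  next
    case (t_var i)
    have "phi x = (potential r r :: (var \<Rightarrow> 'a) \<Rightarrow> 'a)"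
      using r by (auto simp: t_var potential_def quot_def)
    then show ?thesis using r by (simp add: t_var)
  next
    case (w_var i)
    \<comment> \<open>The list stops at \<open>w_var (r - 2)\<close>, so \<open>Suc i\<close> does
      not run into the primed potentials.\<close>
    then have i: "Suc i < r" using x by (auto simp: variables_def)
    have "phi x = (\<lambda>\<eta> :: var \<Rightarrow> 'a. potential r i \<eta> * potential r (Suc i) \<eta>)"
      using i by (auto simp: w_var potential_def quot_def)
    then show ?thesis using i by (simp add: w_var two distrib_right sum.distrib)
  next
    case (s'_var i)
    have "phi x = (potential r r :: (var \<Rightarrow> 'a) \<Rightarrow> 'a)"
      using r by (auto simp: s'_var potential_def quot_def)
    then show ?thesis using r by (simp add: s'_var)
  next
    case (t'_var i)
    have "phi x = (potential r 0 :: (var \<Rightarrow> 'a) \<Rightarrow> 'a)"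
      using r by (auto simp: t'_var potential_def quot_def)
    then show ?thesis using r by (simp add: t'_var)
  next
    case (w'_var i)
    then have i: "Suc i < r'" using x by (auto simp: variables_def)
    have "phi x = (\<lambda>\<eta> :: var \<Rightarrow> 'a. potential r (r + i) \<eta> * potential r (Suc (r + i)) \<eta>)"
      using i by (auto simp: w'_var potential_def quot_def Suc_diff_le)
    then show ?thesis using i by (simp add: w'_var two distrib_right sum.distrib)
  qed
qed

text \<open>Splits the inner products in \<open>B * A\<close> by family.\<close>

lemma sum_variables:
  "(\<Sum>k<length (variables r r'). f (variables r r' ! k)) =
    (\<Sum>i<r. f (s_var i)) + (\<Sum>i<r. f (t_var i)) + (\<Sum>i<r - 1. f (w_var i)) +
    (\<Sum>i<r'. f (s'_var i)) + (\<Sum>i<r'. f (t'_var i)) + (\<Sum>i<r' - 1. f (w'_var i))"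
proof -
  have "(\<Sum>k<length (variables r r'). f (variables r r' ! k)) = sum_list (map f (variables r r'))"
    by (simp add: sum_list_sum_nth atLeast0LessThan)
  then show ?thesis
    by (simp add: variables_def interv_sum_list_conv_sum_set_nat atLeast0LessThan comp_def add.assoc)
qed

section \<open>Reduction and evaluation of \<open>J\<close>\<close>

theorem theorem3p1:
  fixes r r' :: nat
    and s t w s' t' w' :: "nat \<Rightarrow> 'a::real_normed_field"
  assumes "r \<ge> 1" and "r' \<ge> 1"
    and "w (r - 1) = 0" and "w' (r' - 1) = 0"
    and "\<And>i. i < r \<Longrightarrow> 1 + s i + t i \<noteq> 0"
    and "\<And>i. i < r' \<Longrightarrow> 1 + s' i + t' i \<noteq> 0"
    and "\<And>i. i < r - 1 \<Longrightarrow> 1 + w i \<noteq> 0"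
    and "\<And>i. i < r' - 1 \<Longrightarrow> 1 + w' i \<noteq> 0"
  shows "J r r' (case_var s t w s' t' w') = S r s t w * S r' s' t' w' - T r s t w * T r' s' t' w'"
proof -
  define \<eta> where "\<eta> = case_var s t w s' t' w'"
  have \<eta> [simp]: "\<eta> (s_var i) = s i" "\<eta> (t_var i) = t i" "\<eta> (w_var i) = w i"
    "\<eta> (s'_var i) = s' i" "\<eta> (t'_var i) = t' i" "\<eta> (w'_var i) = w' i" for i
    by (simp_all add: \<eta>_def)
  define n where "n = r + r'"
  define D where "D = length (variables r r')"
  define z where "z m = (if m < r then w m else w' (m - r))" for m
  \<comment> \<open>Row scaling: the diagonal \<open>1 - z m / (1 + z m)\<close> equals
    \<open>c m\<close>, and the superdiagonal \<open>- z m / (1 + z m)\<close> equals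
    \<open>- c m * z m\<close>.\<close>
  define c where "c m = 1 / (1 + z m)" for m
  \<comment> \<open>\<open>p\<close> gives column 0 and \<open>q\<close> column \<open>r\<close>, up
    to the factor \<open>c m\<close>. The roles of \<open>s\<close> and \<open>t\<close> swap in the
    primed block, because \<open>phi\<close> is the potential 0 for \<open>s_var\<close> and
    \<open>t'_var\<close>, and the potential \<open>r\<close> for \<open>t_var\<close> and
    \<open>s'_var\<close>.\<close>
  define p where "p m = (if m < r then s m * (1 + w m) / (1 + s m + t m)
    else t' (m - r) * (1 + w' (m - r)) / (1 + s' (m - r) + t' (m - r)))" for m
  define q where "q m = (if m < r then t m * (1 + w m) / (1 + s m + t m)
    else s' (m - r) * (1 + w' (m - r)) / (1 + s' (m - r) + t' (m - r)))" for m
  define A where "A = mat D n (\<lambda>(j, m). expo r (variables r r' ! j) m :: 'a)"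
  define B where "B = mat n D (\<lambda>(m, k). log_deriv (variables r r' ! k) (potential r m) \<eta>)"
  have carr: "A \<in> carrier_mat D n" "B \<in> carrier_mat n D"
    by (simp_all add: A_def B_def)
  \<comment> \<open>The last index is covered by the convention
    \<open>w (r - 1) = 0\<close>.\<close>
  have nz_w: "1 + w i \<noteq> 0" if "i < r" for i
    using that assms(3) assms(7)[of i] by (cases "i = r - 1") auto
  have nz_w': "1 + w' i \<noteq> 0" if "i < r'" for i
    using that assms(4) assms(8)[of i] by (cases "i = r' - 1") auto
  have nz: "potential r m \<eta> \<noteq> 0" if "m < r + r'" for m
    using that assms(5)[of m] assms(6)[of "m - r"] nz_w[of m] nz_w'[of "m - r"]
    by (auto simp: potential_def quot_def)
  have ld: "log_deriv v (potential r m) \<eta> =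
     (if m < r then if v = s_var m \<or> v = t_var m then - \<eta> v / (1 + s m + t m)
        else if v = w_var m then w m / (1 + w m) else 0
      else if v = s'_var (m - r) \<or> v = t'_var (m - r) then - \<eta> v / (1 + s' (m - r) + t' (m - r))
        else if v = w'_var (m - r) then w' (m - r) / (1 + w' (m - r)) else 0)"
    if "m < n" for m v
    using that assms(5)[of m] assms(6)[of "m - r"] nz_w[of m] nz_w'[of "m - r"]
    by (auto simp: potential_def n_def log_deriv_quot)
  have "J r r' \<eta> = det (1\<^sub>m D - A * B)"
  proof -
    have "D = 3 * r + 3 * r' - 2"
      using assms by (simp add: D_def length_variables)
    moreover have "mat D D (\<lambda>(j, k). (if j = k then 1 else 0) -
        \<eta> (variables r r' ! k) / phi (variables r r' ! j) \<eta> *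
        partial_deriv (variables r r' ! k) (phi (variables r r' ! j)) \<eta>) = 1\<^sub>m D - A * B"
    proof (rule eq_matI)
      fix j k assume "j < dim_row (1\<^sub>m D - A * B)" "k < dim_col (1\<^sub>m D - A * B)"
      then have jk: "j < D" "k < D" by (simp_all add: A_def B_def)
      have "variables r r' ! j \<in> set (variables r r')"
        using jk by (simp add: D_def)
      from log_deriv_phi[OF assms(1,2) this nz, of "variables r r' ! k"] jk
      show "mat D D (\<lambda>(j, k). (if j = k then 1 else 0) -
        \<eta> (variables r r' ! k) / phi (variables r r' ! j) \<eta> *
        partial_deriv (variables r r' ! k) (phi (variables r r' ! j)) \<eta>) $$ (j, k) =
        (1\<^sub>m D - A * B) $$ (j, k)"
        by (simp add: A_def B_def scalar_prod_def log_deriv_def n_def atLeast0LessThan)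
    qed (simp_all add: A_def B_def)
    ultimately show ?thesis by (simp add: J_def Let_def)
  qed
  also have "\<dots> = det (1\<^sub>m n - B * A)"
    by (rule det_one_minus_mult_swap[OF carr])
  also have "1\<^sub>m n - B * A = mat n n (\<lambda>(i, j). c i * (of_bool (i = j) - of_bool (j = Suc i) * z i
           + of_bool (j = 0) * p i + of_bool (j = r) * q i))" (is "_ = ?M")
  proof (rule eq_matI)
    fix i j assume "i < dim_row ?M" "j < dim_col ?M"
    then have ij: "i < n" "j < n" by simp_all
    have "(B * A) $$ (i, j) = (\<Sum>k<D. log_deriv (variables r r' ! k) (potential r i) \<eta>
        * expo r (variables r r' ! k) j)"
      using ij by (simp add: A_def B_def scalar_prod_def atLeast0LessThan)
    also have "\<dots> = (if i < r
      then - s i / (1 + s i + t i) * of_bool (j = 0) - t i / (1 + s i + t i) * of_bool (j = r)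
      else - s' (i - r) / (1 + s' (i - r) + t' (i - r)) * of_bool (j = r)
        - t' (i - r) / (1 + s' (i - r) + t' (i - r)) * of_bool (j = 0))
      + z i / (1 + z i) * (of_bool (j = i) + of_bool (j = Suc i))"
    proof (cases "i < r")
      case True
      \<comment> \<open>For \<open>i = r - 1\<close> there is no variable \<open>w_var i\<close> to
        contribute; the formula still holds because its \<open>z i\<close> term vanishes.\<close>
      then have "w i = 0" if "\<not> i < r - 1"
        using that assms(3) by (cases "i = r - 1") auto
      with True show ?thesis
        unfolding D_def sum_variables[of "\<lambda>v. log_deriv v (potential r i) \<eta> * expo r v j"] using ij
        by (auto simp: ld z_def if_distribR if_distrib[of "\<lambda>x. x * _"] cong: if_cong)
    next
      case False
      then have "w' (i - r) = 0" if "\<not> i - r < r' - 1"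
        using that assms(4) ij by (cases "i - r = r' - 1") (auto simp: n_def)
      with False show ?thesis
        unfolding D_def sum_variables[of "\<lambda>v. log_deriv v (potential r i) \<eta> * expo r v j"] using ij
        by (auto simp: ld z_def n_def if_distribR if_distrib[of "\<lambda>x. x * _"] cong: if_cong)
    qed
    also have "\<dots> = c i * z i * (of_bool (j = i) + of_bool (j = Suc i))
        - c i * p i * of_bool (j = 0) - c i * q i * of_bool (j = r)"
      using ij nz_w[of i] nz_w'[of "i - r"] by (simp add: c_def z_def p_def q_def n_def)
    finally have BA: "(B * A) $$ (i, j) = c i * z i * (of_bool (j = i) + of_bool (j = Suc i))
        - c i * p i * of_bool (j = 0) - c i * q i * of_bool (j = r)" .
    \<comment> \<open>Writing the diagonal 1 this way cancels the diagonal term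
      \<open>c i * z i\<close> of \<open>B * A\<close>.\<close>
    have "c i + c i * z i = 1"
      using ij nz_w[of i] nz_w'[of "i - r"] by (simp add: c_def z_def n_def add_divide_distrib[symmetric])
    then have "1\<^sub>m n $$ (i, j) = (c i + c i * z i) * of_bool (j = i)"
      using ij by simp
    then have "(1\<^sub>m n - B * A) $$ (i, j) = (c i + c i * z i) * of_bool (j = i) - (B * A) $$ (i, j)"
      using ij by (simp add: A_def B_def)
    then show "(1\<^sub>m n - B * A) $$ (i, j) = ?M $$ (i, j)"
      using ij unfolding BA by (simp add: algebra_simps)
  qed (simp_all add: A_def B_def)
  also have "det \<dots> = (\<Prod>i<n. c i) * ((1 + tail_sum n z p 0) * (1 + tail_sum n z q r)
           - tail_sum n z q 0 * tail_sum n z p r)"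
    using assms by (intro det_bidiagonal_plus_two_columns) (auto simp: n_def)
  also have "(\<Prod>i<n. c i) = 1 / W r w * (1 / W r' w')"
  proof -
    \<comment> \<open>\<open>W\<close> has one factor fewer; the extra factor is 1 since
      \<open>u (k - 1) = 0\<close>.\<close>
    have last: "(\<Prod>i<k. 1 / (1 + u i)) = 1 / W k u" if "k \<ge> 1" "u (k - 1) = 0" for k and u :: "nat \<Rightarrow> 'a"
      using that by (cases k) (simp_all add: W_def prod_dividef)
    have "(\<Prod>i<n. c i) = (\<Prod>i<r. 1 / (1 + w i)) * (\<Prod>i<r'. 1 / (1 + w' i))"
      using prod.atLeastLessThan_concat[of 0 r n c] prod.shift_bounds_nat_ivl[of c 0 r r']
      by (simp add: n_def c_def z_def atLeast0LessThan add.commute)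
    then show ?thesis using assms last by simp
  qed
  also have "tail_sum n z p 0 = (\<Sum>j<r. s j * (1 + w j) / (1 + s j + t j) * (\<Prod>k<j. w k))"
  proof -
    \<comment> \<open>Here \<open>z (r - 1) = w (r - 1) = 0\<close> removes the primed
      block.\<close>
    have "tail_sum n z p 0 = tail_sum r z p 0"
      unfolding n_def using assms by (intro tail_sum_cut) (auto simp: z_def)
    also have "\<dots> = tail_sum r w (\<lambda>j. s j * (1 + w j) / (1 + s j + t j)) 0"
      by (intro tail_sum_cong) (auto simp: z_def p_def)
    finally show ?thesis by (simp add: tail_sum_def atLeast0LessThan)
  qed
  also have "tail_sum n z q 0 = (\<Sum>j<r. t j * (1 + w j) / (1 + s j + t j) * (\<Prod>k<j. w k))"
  proof -
    have "tail_sum n z q 0 = tail_sum r z q 0"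
      unfolding n_def using assms by (intro tail_sum_cut) (auto simp: z_def)
    also have "\<dots> = tail_sum r w (\<lambda>j. t j * (1 + w j) / (1 + s j + t j)) 0"
      by (intro tail_sum_cong) (auto simp: z_def q_def)
    finally show ?thesis by (simp add: tail_sum_def atLeast0LessThan)
  qed
  \<comment> \<open>A tail starting at \<open>r\<close> lies entirely in the primed block, where
    \<open>q\<close> carries \<open>s'\<close> and \<open>p\<close> carries
    \<open>t'\<close>.\<close>
  also have "tail_sum n z q r = (\<Sum>j<r'. s' j * (1 + w' j) / (1 + s' j + t' j) * (\<Prod>k<j. w' k))"
    unfolding n_def tail_sum_shift by (simp add: z_def q_def tail_sum_def atLeast0LessThan)
  also have "tail_sum n z p r = (\<Sum>j<r'. t' j * (1 + w' j) / (1 + s' j + t' j) * (\<Prod>k<j. w' k))"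
    unfolding n_def tail_sum_shift by (simp add: z_def p_def tail_sum_def atLeast0LessThan)
  finally show ?thesis
    unfolding \<eta>_def S_def T_def by (simp only: algebra_simps)
qed

end
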